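(* Let $(\mathbb{X},\|\cdot\|)$ be a smooth and strictly convex finite dimensional real normed space with unit ball $\mathbf{B}$ and semi-inner product $[\cdot,\cdot]$. Let $M,N\subset\mathbb{X}$ and let $\lambda\ne0$ be a real number. Then (i) $M\subseteq N$ implies $N^\circ\subseteq M^\circ$ and $N_\circ\subseteq M_\circ$; (ii) $(M\cup N)^\circ=M^\circ\cap N^\circ$ and $(M\cup N)_\circ=M_\circ\cap N_\circ$; (iii) $(\lambda M)^\circ=(1/\lambda)M^\circ$ and $(\lambda M)_\circ=(1/\lambda)M_\circ$; (iv) $\mathbf{B}^\circ=\mathbf{B}_\circ=\mathbf{B}$; (v) if $M$ is a convex body containing the origin $o$ as an interior point, then $(M_\circ)^\circ=M$.
   Context: With the dual norm $\|f\|^\ast=\sup\{f(x):\|x\|=1\}$ on $\mathbb{X}^\ast$, for $y\in\mathbb{X}$ let $f_y\in\mathbb{X}^\ast$ be the unique functional with $\|f_y\|^\ast=\|y\|$ and $f_y(y)=\|y\|^2$. The semi-inner product induced by the norm is $[x,y]=f_y(x)$. For $M\subset\mathbb{X}$, the left semi-polar of $M$ is $M_\circ=\{x\in\mathbb{X}:[m,x]\le1\text{ for all }m\in M\}$ and the right semi-polar of $M$ is $M^\circ=\{x\in\mathbb{X}:[x,m]\le1\text{ for all }m\in M\}$. A convex body is a compact convex set with nonempty interior. The unit ball is $\mathbf{B}=\{x:\|x\|\le1\}$. *)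

theory Defs
  imports "HOL-Analysis.Analysis"
begin

definition finite_dimensional :: "'a::real_normed_vector itself \<Rightarrow> bool" where
  "finite_dimensional _ \<longleftrightarrow> (\<exists>B::'a set. finite B \<and> span B = UNIV)"

definition supporting_hyperplane_at ::
    "'a::real_normed_vector set \<Rightarrow> 'a \<Rightarrow> 'a set \<Rightarrow> bool" where
  "supporting_hyperplane_at S x H \<longleftrightarrow>
     (\<exists>f::'a \<Rightarrow>\<^sub>L real. f \<noteq> 0 \<and> H = {z. blinfun_apply f z = blinfun_apply f x} \<and>
       (\<forall>z\<in>S. blinfun_apply f z \<le> blinfun_apply f x))"

definition smooth_space :: "'a::real_normed_vector itself \<Rightarrow> bool" where
  "smooth_space _ \<longleftrightarrow>
     (\<forall>x\<in>sphere (0::'a) 1. \<exists>!H. supporting_hyperplane_at (cball 0 1) x H)"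

definition strictly_convex_space :: "'a::real_normed_vector itself \<Rightarrow> bool" where
  "strictly_convex_space _ \<longleftrightarrow>
     (\<forall>x y::'a. closed_segment x y \<subseteq> sphere 0 1 \<longrightarrow> x = y)"

text \<open>
  The dual space is the type of bounded linear functionals, and the dual norm is its
  operator norm. The next lemma rewrites it as a supremum over the unit sphere; the
  hypothesis only excludes the zero space, where that sphere is empty.
\<close>

lemma dual_norm_eq_Sup:
  fixes f :: "'a::real_normed_vector \<Rightarrow>\<^sub>L real"
  assumes "\<exists>x::'a. x \<noteq> 0"
  shows "norm f = Sup {f x | x. norm x = 1}"
proof (rule antisym)
  let ?S = "{f x | x. norm x = 1}"
  have le: "f x \<le> norm f" if "norm x = 1" for x
    using norm_blinfun[of f x] that by auto
  have bdd: "bdd_above ?S"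
    using le by (auto intro!: bdd_aboveI)
  obtain a :: 'a where a: "a \<noteq> 0" using assms by blast
  have na: "norm (a /\<^sub>R norm a) = 1" using a by simp
  have ne: "?S \<noteq> {}" using na by blast
  show "Sup ?S \<le> norm f"
    using ne le by (intro cSup_least) auto
  have up: "\<bar>f x\<bar> \<le> Sup ?S" if "norm x = 1" for x
  proof -
    have "f x \<le> Sup ?S" using that bdd by (intro cSup_upper) auto
    moreover have "f (- x) \<le> Sup ?S" using that bdd by (intro cSup_upper) (auto intro!: exI[of _ "- x"])
    ultimately show ?thesis by (simp add: blinfun.minus_right abs_if)
  qed
  have "0 \<le> Sup ?S" using up[OF na] by linarith
  then show "norm f \<le> Sup ?S"
  proof (rule norm_blinfun_bound)
    fix x :: 'a
    show "norm (f x) \<le> Sup ?S * norm x"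
    proof (cases "x = 0")
      case False
      then have "norm (x /\<^sub>R norm x) = 1" by simp
      from up[OF this] False show ?thesis
        by (simp add: blinfun.scaleR_right abs_mult field_simps)
    qed simp
  qed
qed

text \<open>The functional \<open>f\<^sub>y\<close>; it is unique in smooth spaces.\<close>

definition norming_functional :: "'a::real_normed_vector \<Rightarrow> ('a \<Rightarrow>\<^sub>L real)" where
  "norming_functional y = (THE f::'a \<Rightarrow>\<^sub>L real. norm f = norm y \<and> blinfun_apply f y = (norm y)\<^sup>2)"

definition semi_inner :: "'a::real_normed_vector \<Rightarrow> 'a \<Rightarrow> real" where
  "semi_inner x y = norming_functional y x"

definition left_semipolar :: "'a::real_normed_vector set \<Rightarrow> 'a set" where
  "left_semipolar M = {x. \<forall>m\<in>M. semi_inner m x \<le> 1}"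

definition right_semipolar :: "'a::real_normed_vector set \<Rightarrow> 'a set" where
  "right_semipolar M = {x. \<forall>m\<in>M. semi_inner x m \<le> 1}"

definition convex_body :: "'a::real_normed_vector set \<Rightarrow> bool" where
  "convex_body K \<longleftrightarrow> compact K \<and> convex K \<and> interior K \<noteq> {}"

end

theory Submission imports Defs begin

text \<open>
  Everything rests on the duality map \<open>y \<mapsto> f\<^sub>y\<close>.  Smoothness makes it well defined: a supporting
  hyperplane of the ball at a unit vector is the same thing as a functional norming that vector,
  up to scaling.  Uniqueness then gives the homogeneity \<open>f\<^bsub>c y\<^esub> = c f\<^sub>y\<close>, hence
  the behaviour of semi-polars under scaling, and \<open>f\<^sub>y x \<le> \<parallel>y\<parallel> \<parallel>x\<parallel>\<close> with equality at \<open>x = y\<close>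
  shows that the unit ball is self-polar.

  The substance is the bipolar identity \<open>(M\<^sub>\<circ>)\<^sup>\<circ> = M\<close>.  The inclusion of \<open>M\<close> in \<open>(M\<^sub>\<circ>)\<^sup>\<circ>\<close> is immediate.  For the
  other one, a point \<open>x\<close> outside \<open>M\<close> has a nearest point \<open>p\<close> in \<open>M\<close>, and the duality map itself
  supplies the separating functional: \<open>f\<^bsub>x - p\<^esub>\<close> is maximal over \<open>M\<close> at \<open>p\<close> (the variational
  inequality, \<open>norming_functional_nearest_point\<close>).  Its value \<open>s\<close> at \<open>p\<close> is positive because \<open>0\<close> is
  interior, and it is larger still at \<open>x\<close>; so by homogeneity \<open>y = (x - p) / s\<close> lies in \<open>M\<^sub>\<circ>\<close> and
  satisfies \<open>[x, y] > 1\<close>.  Thus the separating functional has the form \<open>f\<^sub>y\<close> by construction.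

  In a Hilbert space the variational inequality is a derivative computation.  Here it follows from
  continuity of the duality map from the norm topology to the topology of pointwise convergence
  (\<open>tendsto_norming_functional\<close>), which combines uniqueness of \<open>f\<^sub>y\<close> with pointwise compactness of
  bounded sets of functionals (Banach--Alaoglu).
\<close>

section \<open>The duality map of a smooth space\<close>

text \<open>
  Existence comes from a supporting functional, divided by its norm; uniqueness because a functional
  \<open>f\<close> with \<open>f y = 1\<close> is determined by the hyperplane \<open>{z. f z = 1}\<close>.
\<close>

lemma ex1_norming_functional_unit:
  fixes y :: "'a::real_normed_vector"
  assumes "smooth_space TYPE('a)" and y: "norm y = 1"
  shows "\<exists>!f::'a \<Rightarrow>\<^sub>L real. norm f = 1 \<and> blinfun_apply f y = 1"
proof (rule ex_ex1I)
  have ex1: "\<exists>!H. supporting_hyperplane_at (cball 0 1) y H"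
    using assms unfolding smooth_space_def by (auto simp: dist_norm)
  then obtain f :: "'a \<Rightarrow>\<^sub>L real" where f: "f \<noteq> 0" "\<And>z. norm z \<le> 1 \<Longrightarrow> f z \<le> f y"
    unfolding supporting_hyperplane_at_def by auto
  have "norm f \<le> f y"
  proof (rule norm_blinfun_bound)
    show "0 \<le> f y" using f(2)[of 0] by (simp add: blinfun.zero_right)
    fix x show "norm (f x) \<le> f y * norm x"
    proof (cases "x = 0")
      case False
      then have "f (x /\<^sub>R norm x) \<le> f y" "f (- (x /\<^sub>R norm x)) \<le> f y"
        by (intro f(2); simp)+
      with False show ?thesis
        by (auto simp: blinfun.scaleR_right blinfun.minus_right abs_le_iff field_simps)
    qed (simp add: blinfun.zero_right)
  qed
  moreover have "f y \<le> norm f" using norm_blinfun[of f y] y by simp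
  ultimately have "norm f = f y" by simp
  then have "f y > 0" and "norm f = f y" using f(1) by (auto simp flip: zero_less_norm_iff)
  then have "norm (f /\<^sub>R norm f) = 1 \<and> blinfun_apply (f /\<^sub>R norm f) y = 1"
    using f(1) by (simp add: blinfun.scaleR_left)
  then show "\<exists>f::'a \<Rightarrow>\<^sub>L real. norm f = 1 \<and> blinfun_apply f y = 1" by blast
next
  fix f g :: "'a \<Rightarrow>\<^sub>L real"
  assume f: "norm f = 1 \<and> blinfun_apply f y = 1" and g: "norm g = 1 \<and> blinfun_apply g y = 1"
  have supp: "supporting_hyperplane_at (cball 0 1) y {z. blinfun_apply h z = 1}"
    if h: "norm h = 1 \<and> blinfun_apply h y = 1" for h :: "'a \<Rightarrow>\<^sub>L real"
    unfolding supporting_hyperplane_at_def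
  proof (intro exI[of _ h] conjI ballI)
    fix z :: 'a assume "z \<in> cball 0 1"
    then show "h z \<le> h y" using norm_blinfun[of h z] h by auto
  qed (use h in auto)
  have "\<exists>!H. supporting_hyperplane_at (cball 0 1) y H"
    using assms unfolding smooth_space_def by (auto simp: dist_norm)
  with supp[OF f] supp[OF g]
  have "{z. blinfun_apply f z = 1} = {z. blinfun_apply g z = 1}" by blast
  then have eq: "f z = 1 \<longleftrightarrow> g z = 1" for z by blast
  show "f = g"
  proof (rule blinfun_eqI)
    fix z
    show "f z = g z"
    proof (cases "f z = 0")
      case True
      then have "f (y + z) = 1" using f by (simp add: blinfun.add_right)
      then have "g (y + z) = 1" by (simp add: eq)
      then show ?thesis using g True by (simp add: blinfun.add_right)
    next
      case False
      then have "f (z /\<^sub>R f z) = 1" by (simp add: blinfun.scaleR_right)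
      then have "g (z /\<^sub>R f z) = 1" by (simp add: eq)
      then show ?thesis using False by (simp add: blinfun.scaleR_right field_simps)
    qed
  qed
qed

lemma ex1_norming_functional:
  fixes y :: "'a::real_normed_vector"
  assumes "smooth_space TYPE('a)"
  shows "\<exists>!f::'a \<Rightarrow>\<^sub>L real. norm f = norm y \<and> blinfun_apply f y = (norm y)\<^sup>2"
proof (cases "y = 0")
  case True
  then show ?thesis by (auto simp: blinfun.zero_left)
next
  case False
  let ?u = "y /\<^sub>R norm y"
  have iff: "norm f = norm y \<and> f y = (norm y)\<^sup>2 \<longleftrightarrow>
      norm (f /\<^sub>R norm y) = 1 \<and> blinfun_apply (f /\<^sub>R norm y) ?u = 1" for f :: "'a \<Rightarrow>\<^sub>L real"
    using False
    by (auto simp: blinfun.scaleR_left blinfun.scaleR_right power2_eq_square field_simps)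
  obtain g :: "'a \<Rightarrow>\<^sub>L real" where g: "norm g = 1 \<and> g ?u = 1"
    and uniq: "\<And>h :: 'a \<Rightarrow>\<^sub>L real. norm h = 1 \<and> blinfun_apply h ?u = 1 \<Longrightarrow> h = g"
    using ex1_norming_functional_unit[OF assms, of ?u] False by auto
  show ?thesis
  proof (rule ex1I[of _ "norm y *\<^sub>R g"])
    show "norm (norm y *\<^sub>R g) = norm y \<and> blinfun_apply (norm y *\<^sub>R g) y = (norm y)\<^sup>2"
      using g False by (subst iff) simp
    fix f :: "'a \<Rightarrow>\<^sub>L real" assume "norm f = norm y \<and> blinfun_apply f y = (norm y)\<^sup>2"
    then have "f /\<^sub>R norm y = g" using iff uniq by blast
    then show "f = norm y *\<^sub>R g" using False by auto
  qed
qed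

lemma
  fixes y :: "'a::real_normed_vector"
  assumes "smooth_space TYPE('a)"
  shows norm_norming_functional: "norm (norming_functional y) = norm y"
    and norming_functional_self: "norming_functional y y = (norm y)\<^sup>2"
  using theI'[OF ex1_norming_functional[OF assms, of y]]
  unfolding norming_functional_def by auto

lemma norming_functional_unique:
  fixes y :: "'a::real_normed_vector"
  assumes "smooth_space TYPE('a)" and "norm f = norm y" and "blinfun_apply f y = (norm y)\<^sup>2"
  shows "f = norming_functional y"
  using the1_equality[OF ex1_norming_functional[OF assms(1), of y]] assms(2,3)
  unfolding norming_functional_def by auto

lemma norming_functional_scaleR:
  fixes y :: "'a::real_normed_vector"
  assumes "smooth_space TYPE('a)"
  shows "norming_functional (c *\<^sub>R y) = c *\<^sub>R norming_functional y"
  by (rule norming_functional_unique[OF assms, symmetric])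
     (simp_all add: norm_norming_functional[OF assms] norming_functional_self[OF assms]
        blinfun.scaleR_left blinfun.scaleR_right power_mult_distrib, simp add: power2_eq_square)

section \<open>Continuity of the duality map\<close>

text \<open>
  Banach--Alaoglu: viewed as functions, the functionals of norm at most \<open>C\<close> lie in a product of
  compact intervals.  A cluster point in the product is linear and bounded, since both properties are
  closed under pointwise limits.  The finer filter plays the role of a convergent subnet.
\<close>

lemma bounded_functionals_pointwise_cluster:
  fixes \<Phi> :: "'i \<Rightarrow> 'a::real_normed_vector \<Rightarrow>\<^sub>L real"
  assumes F: "F \<noteq> bot" and bnd: "\<forall>\<^sub>F i in F. norm (\<Phi> i) \<le> C"
  obtains G and g :: "'a \<Rightarrow>\<^sub>L real"
    where "G \<le> F" "G \<noteq> bot" "\<And>x. ((\<lambda>i. \<Phi> i x) \<longlongrightarrow> g x) G"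
proof -
  let ?\<Psi> = "\<lambda>i. blinfun_apply (\<Phi> i)"
  let ?K = "PiE UNIV (\<lambda>x::'a. cball (0::real) (C * norm x))"
  have "compact ?K"
    using compactin_PiE[of "\<lambda>_::'a. euclidean :: real topology" UNIV "\<lambda>x. cball 0 (C * norm x)"]
    unfolding euclidean_product_topology compactin_euclidean_iff by simp
  moreover have "\<forall>\<^sub>F h in filtermap ?\<Psi> F. h \<in> ?K"
    unfolding eventually_filtermap using bnd
  proof eventually_elim
    case (elim i)
    have "norm (\<Phi> i x) \<le> C * norm x" for x
      using norm_blinfun[of "\<Phi> i" x] mult_right_mono[OF elim norm_ge_zero[of x]] by linarith
    then show ?case by (simp add: PiE_iff)
  qed
  ultimately obtain k where k: "inf (nhds k) (filtermap ?\<Psi> F) \<noteq> bot"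
    using F unfolding compact_filter by (metis filtermap_bot_iff)
  define G where "G = inf F (filtercomap ?\<Psi> (nhds k))"
  have GF: "G \<le> F" unfolding G_def by simp
  have Gbot: "G \<noteq> bot"
  proof
    assume "G = bot"
    then have "eventually (\<lambda>_. False) (inf F (filtercomap ?\<Psi> (nhds k)))"
      unfolding G_def by simp
    then obtain P Q where PQ: "eventually P F" "eventually Q (nhds k)" "\<And>i. P i \<Longrightarrow> \<not> Q (?\<Psi> i)"
      unfolding eventually_inf eventually_filtercomap by metis
    then have "eventually (\<lambda>h. \<not> Q h) (filtermap ?\<Psi> F)"
      unfolding eventually_filtermap by (auto elim: eventually_mono)
    with PQ(2) have "eventually (\<lambda>_. False) (inf (nhds k) (filtermap ?\<Psi> F))"
      unfolding eventually_inf by blast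
    with k show False by (simp add: eventually_False)
  qed
  have "(?\<Psi> \<longlongrightarrow> k) G"
    unfolding filterlim_def G_def
    by (rule order_trans[OF filtermap_mono[OF inf_le2] filtermap_filtercomap])
  then have lim: "((\<lambda>i. \<Phi> i x) \<longlongrightarrow> k x) G" for x
    by (rule continuous_on_tendsto_compose[OF continuous_on_product_coordinates[of x]]) auto
  have "bounded_linear k"
  proof (rule bounded_linear_intro[where K = C])
    fix x y and r :: real
    have "((\<lambda>i. \<Phi> i (x + y)) \<longlongrightarrow> k x + k y) G"
      using tendsto_add[OF lim lim] by (simp add: blinfun.add_right)
    then show "k (x + y) = k x + k y" using tendsto_unique[OF Gbot lim] by blast
    have "((\<lambda>i. \<Phi> i (r *\<^sub>R x)) \<longlongrightarrow> r *\<^sub>R k x) G"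
      using tendsto_scaleR[OF tendsto_const lim] by (simp add: blinfun.scaleR_right)
    then show "k (r *\<^sub>R x) = r *\<^sub>R k x" using tendsto_unique[OF Gbot lim] by blast
    have "\<forall>\<^sub>F i in G. norm (\<Phi> i x) \<le> norm x * C"
      using filter_leD[OF GF bnd]
    proof eventually_elim
      case (elim i)
      show ?case
        using norm_blinfun[of "\<Phi> i" x] mult_right_mono[OF elim norm_ge_zero[of x]]
        by (simp add: mult.commute)
    qed
    then show "norm (k x) \<le> norm x * C"
      using tendsto_upperbound[OF tendsto_norm[OF lim] _ Gbot] by blast
  qed
  then have "blinfun_apply (Blinfun k) = k" by (rule bounded_linear_Blinfun_apply)
  then show thesis using that[of G "Blinfun k"] GF Gbot lim by simp
qed

text \<open>
  Every cluster point of \<open>f\<^bsub>y i\<^esub>\<close> norms the limit \<open>u\<close>, as both the bound on the norm and the value at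
  the base point pass to the limit; by uniqueness \<open>f\<^sub>u\<close> is the only cluster point.
\<close>

lemma tendsto_norming_functional:
  fixes u :: "'a::real_normed_vector"
  assumes sm: "smooth_space TYPE('a)" and y: "(y \<longlongrightarrow> u) F"
  shows "((\<lambda>i. norming_functional (y i) v) \<longlongrightarrow> norming_functional u v) F"
proof (rule ccontr)
  assume "\<not> ?thesis"
  then obtain S where S: "open S" "norming_functional u v \<in> S"
    and "\<not> (\<forall>\<^sub>F i in F. norming_functional (y i) v \<in> S)"
    unfolding tendsto_def by blast
  then have F': "inf F (principal {i. norming_functional (y i) v \<notin> S}) \<noteq> bot" (is "?F' \<noteq> bot")
    by (simp add: trivial_limit_def eventually_inf_principal)
  have y': "(y \<longlongrightarrow> u) ?F'" using y by (rule tendsto_mono[rotated]) simp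
  have "\<forall>\<^sub>F i in ?F'. norm (y i) < norm u + 1"
    using tendsto_norm[OF y'] by (rule order_tendstoD) simp
  then have "\<forall>\<^sub>F i in ?F'. norm (norming_functional (y i)) \<le> norm u + 1"
    by (rule eventually_mono) (simp add: norm_norming_functional[OF sm])
  from bounded_functionals_pointwise_cluster[OF F' this]
  obtain G g where G: "G \<le> ?F'" "G \<noteq> bot"
    and lim: "\<And>x. ((\<lambda>i. norming_functional (y i) x) \<longlongrightarrow> blinfun_apply g x) G" by blast
  have yG: "(y \<longlongrightarrow> u) G" using y' G(1) tendsto_mono by blast
  have bound: "norm (norming_functional (y i) x) \<le> norm (y i) * norm x" for i x
    using norm_blinfun[of "norming_functional (y i)" x] by (simp add: norm_norming_functional[OF sm])
  have le: "norm g \<le> norm u"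
  proof (rule norm_blinfun_bound)
    fix x
    show "norm (g x) \<le> norm u * norm x"
      by (rule tendsto_le[OF G(2) tendsto_mult[OF tendsto_norm[OF yG] tendsto_const]
            tendsto_norm[OF lim]]) (simp add: bound del: real_norm_def)
  qed simp
  have "((\<lambda>i. norming_functional (y i) (y i) - norming_functional (y i) (y i - u)) \<longlongrightarrow> (norm u)\<^sup>2 - 0) G"
  proof (rule tendsto_diff)
    show "((\<lambda>i. norming_functional (y i) (y i)) \<longlongrightarrow> (norm u)\<^sup>2) G"
      unfolding norming_functional_self[OF sm] by (intro tendsto_intros yG)
    have "((\<lambda>i. norm (y i) * norm (y i - u)) \<longlongrightarrow> norm u * norm (u - u)) G"
      by (intro tendsto_intros yG)
    then have lim0: "((\<lambda>i. norm (y i) * norm (y i - u)) \<longlongrightarrow> 0) G" by simp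
    show "((\<lambda>i. norming_functional (y i) (y i - u)) \<longlongrightarrow> 0) G"
      by (rule Lim_null_comparison[OF _ lim0]) (intro always_eventually allI bound)
  qed
  then have "((\<lambda>i. norming_functional (y i) u) \<longlongrightarrow> (norm u)\<^sup>2) G"
    by (simp add: blinfun.diff_right)
  then have gu: "g u = (norm u)\<^sup>2" using tendsto_unique[OF G(2) lim] by blast
  have "norm u \<le> norm g"
  proof (cases "u = 0")
    case False
    have "norm u * norm u \<le> norm g * norm u"
      using norm_blinfun[of g u] gu by (simp add: power2_eq_square)
    with False show ?thesis by simp
  qed simp
  with le gu have "g = norming_functional u" by (intro norming_functional_unique[OF sm]) auto
  then have "\<forall>\<^sub>F i in G. norming_functional (y i) v \<in> S"
    using lim[of v] S by (auto dest: topological_tendstoD)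
  moreover have "\<forall>\<^sub>F i in G. norming_functional (y i) v \<notin> S"
    using G(1) by (rule filter_leD) (simp add: eventually_inf_principal)
  ultimately have "\<forall>\<^sub>F i in G. False" by eventually_elim blast
  with G(2) show False by simp
qed

section \<open>Separation by the duality map\<close>

text \<open>
  Write \<open>u = x - p\<close> and \<open>v = z - p\<close>.  Moving from \<open>p\<close> towards \<open>z\<close> does not decrease the distance
  to \<open>x\<close>, so \<open>\<parallel>u\<parallel> \<le> \<parallel>w\<parallel>\<close> for \<open>w = u - t v\<close>, \<open>0 < t < 1\<close>; as \<open>f\<^sub>w w = \<parallel>w\<parallel>\<^sup>2\<close> while \<open>f\<^sub>w u \<le> \<parallel>w\<parallel> \<parallel>u\<parallel>\<close>, this
  gives \<open>f\<^sub>w v \<le> 0\<close>.  Continuity of the duality map lets \<open>t\<close> tend to \<open>0\<close>.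
\<close>

lemma norming_functional_nearest_point:
  fixes x p z :: "'a::real_normed_vector"
  assumes sm: "smooth_space TYPE('a)" and "convex M" and "p \<in> M" and "z \<in> M"
    and near: "\<And>q. q \<in> M \<Longrightarrow> norm (x - p) \<le> norm (x - q)"
  shows "norming_functional (x - p) z \<le> norming_functional (x - p) p"
proof -
  define u v where "u = x - p" and "v = z - p"
  have neg: "norming_functional (u - t *\<^sub>R v) v \<le> 0" if t: "0 < t" "t < 1" for t
  proof -
    define w where "w = u - t *\<^sub>R v"
    have "(1 - t) *\<^sub>R p + t *\<^sub>R z \<in> M"
      using assms t by (intro convexD) auto
    from near[OF this] have le: "norm u \<le> norm w"
      by (simp add: w_def u_def v_def algebra_simps)
    have "(norm w)\<^sup>2 = norming_functional w u - t * norming_functional w v"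
      by (simp add: w_def blinfun.diff_right blinfun.scaleR_right
            flip: norming_functional_self[OF sm])
    also have "norming_functional w u \<le> norm w * norm u"
      using norm_blinfun[of "norming_functional w" u] by (simp add: norm_norming_functional[OF sm])
    also have "\<dots> \<le> norm w * norm w" using le by (intro mult_left_mono) auto
    finally have "t * norming_functional w v \<le> 0" by (simp add: power2_eq_square)
    then show ?thesis using t by (simp add: w_def mult_le_0_iff)
  qed
  have "((\<lambda>t::real. u - t *\<^sub>R v) \<longlongrightarrow> u - 0 *\<^sub>R v) (at_right 0)" by (intro tendsto_intros)
  then have "((\<lambda>t. norming_functional (u - t *\<^sub>R v) v) \<longlongrightarrow> norming_functional u v) (at_right 0)"
    by (intro tendsto_norming_functional[OF sm]) simp
  moreover have "\<forall>\<^sub>F t in at_right (0::real). norming_functional (u - t *\<^sub>R v) v \<le> 0"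
    by (rule eventually_at_rightI[of 0 1]) (auto intro: neg)
  ultimately have "norming_functional u v \<le> 0"
    by (rule tendsto_upperbound) simp
  then show ?thesis by (simp add: u_def v_def blinfun.diff_right)
qed

lemma nearest_point_exists:
  fixes x :: "'a::real_normed_vector"
  assumes "compact M" and "M \<noteq> {}"
  obtains p where "p \<in> M" "\<And>q. q \<in> M \<Longrightarrow> norm (x - p) \<le> norm (x - q)"
proof -
  have "continuous_on M (\<lambda>q. norm (x - q))" by (intro continuous_intros)
  from continuous_attains_inf[OF assms this] that show thesis by blast
qed

text \<open>
  Since \<open>M\<close> contains a small multiple of \<open>x - p\<close>, the maximum \<open>s\<close> of \<open>f\<^bsub>x - p\<^esub>\<close> over \<open>M\<close> is positive,
  and the functional can be normalised so that this maximum is \<open>1\<close>.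
\<close>

lemma left_semipolar_separates:
  fixes x :: "'a::real_normed_vector"
  assumes sm: "smooth_space TYPE('a)" and "compact M" "convex M" "0 \<in> interior M" and x: "x \<notin> M"
  obtains y where "y \<in> left_semipolar M" "semi_inner x y > 1"
proof -
  obtain r where r: "r > 0" "cball 0 r \<subseteq> M" using assms(4) by (auto simp: mem_interior_cball)
  then have "M \<noteq> {}" by force
  then obtain p where p: "p \<in> M" "\<And>q. q \<in> M \<Longrightarrow> norm (x - p) \<le> norm (x - q)"
    using nearest_point_exists[OF assms(2)] by blast
  let ?f = "norming_functional (x - p)"
  define s where "s = ?f p"
  have max: "?f z \<le> s" if "z \<in> M" for z
    unfolding s_def using norming_functional_nearest_point[OF sm assms(3) p(1) that p(2)] .
  have ne: "x - p \<noteq> 0" using x p(1) by auto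
  have "(r / norm (x - p)) *\<^sub>R (x - p) \<in> M" using r ne by (intro subsetD[OF r(2)]) simp
  from max[OF this] have "r * norm (x - p) \<le> s"
    using ne by (simp add: blinfun.scaleR_right norming_functional_self[OF sm] power2_eq_square)
  moreover have "0 < r * norm (x - p)" using r ne by simp
  ultimately have s: "s > 0" by linarith
  have "?f x - s = (norm (x - p))\<^sup>2"
    by (simp add: s_def flip: norming_functional_self[OF sm] blinfun.diff_right)
  moreover have "0 < (norm (x - p))\<^sup>2" using ne by simp
  ultimately have gt: "?f x > s" by linarith
  define y where "y = (x - p) /\<^sub>R s"
  have scaled: "semi_inner z y = ?f z / s" for z
    unfolding y_def semi_inner_def norming_functional_scaleR[OF sm]
    by (simp add: blinfun.scaleR_left divide_inverse mult.commute)
  show thesis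
  proof
    show "y \<in> left_semipolar M"
      using max s by (simp add: left_semipolar_def scaled field_simps)
    show "semi_inner x y > 1"
      unfolding scaled using gt s by (simp add: field_simps)
  qed
qed

section \<open>Semi-polars\<close>

lemma semi_inner_scaleR_left: "semi_inner (c *\<^sub>R x) y = c * semi_inner x y"
  by (simp add: semi_inner_def blinfun.scaleR_right)

lemma semi_inner_scaleR_right:
  fixes x :: "'a::real_normed_vector"
  assumes "smooth_space TYPE('a)"
  shows "semi_inner x (c *\<^sub>R y) = c * semi_inner x y"
  by (simp add: semi_inner_def norming_functional_scaleR[OF assms] blinfun.scaleR_left)

lemma semi_inner_self:
  fixes x :: "'a::real_normed_vector"
  assumes "smooth_space TYPE('a)"
  shows "semi_inner x x = (norm x)\<^sup>2"
  by (simp add: semi_inner_def norming_functional_self[OF assms])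

lemma semi_inner_le_norm:
  fixes x :: "'a::real_normed_vector"
  assumes "smooth_space TYPE('a)"
  shows "semi_inner x y \<le> norm x * norm y"
  using norm_blinfun[of "norming_functional y" x]
  by (simp add: semi_inner_def norm_norming_functional[OF assms] mult.commute)

lemma mem_scaleR_image_iff:
  fixes A :: "'a::real_vector set"
  assumes "c \<noteq> 0"
  shows "x \<in> (*\<^sub>R) (1 / c) ` A \<longleftrightarrow> c *\<^sub>R x \<in> A"
  using assms by (auto simp: image_iff intro!: bexI[of _ "c *\<^sub>R x"])

lemma semipolar_scaleR_image:
  fixes M :: "'a::real_normed_vector set"
  assumes "smooth_space TYPE('a)" and "c \<noteq> 0"
  shows "right_semipolar ((*\<^sub>R) c ` M) = (*\<^sub>R) (1 / c) ` right_semipolar M"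
    and "left_semipolar ((*\<^sub>R) c ` M) = (*\<^sub>R) (1 / c) ` left_semipolar M"
  unfolding set_eq_iff mem_scaleR_image_iff[OF assms(2)]
  by (simp_all add: right_semipolar_def left_semipolar_def semi_inner_scaleR_left
        semi_inner_scaleR_right[OF assms(1)])

text \<open>Testing against the unit vector \<open>x / \<parallel>x\<parallel>\<close> recovers \<open>\<parallel>x\<parallel>\<close> in either argument.\<close>

lemma semipolar_cball:
  assumes sm: "smooth_space TYPE('a::real_normed_vector)"
  shows "right_semipolar (cball (0::'a) 1) = cball 0 1"
    and "left_semipolar (cball (0::'a) 1) = cball 0 1"
proof -
  have le: "semi_inner x y \<le> 1" if "norm x \<le> 1" "norm y \<le> 1" for x y :: 'a
    using semi_inner_le_norm[OF sm, of x y] mult_le_one[OF that(1) norm_ge_zero that(2)] by linarith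
  have unit: "x /\<^sub>R norm x \<in> cball 0 1" for x :: 'a
    by (cases "x = 0") auto
  have norm: "semi_inner x (x /\<^sub>R norm x) = norm x" "semi_inner (x /\<^sub>R norm x) x = norm x" for x :: 'a
    by (cases "x = 0"; simp add: semi_inner_scaleR_left semi_inner_scaleR_right[OF sm]
        semi_inner_self[OF sm] power2_eq_square)+
  show "right_semipolar (cball (0::'a) 1) = cball 0 1"
    "left_semipolar (cball (0::'a) 1) = cball 0 1"
    unfolding right_semipolar_def left_semipolar_def
    using le unit norm by (auto, (metis mem_cball_0)+)
qed

lemma right_semipolar_left_semipolar:
  fixes M :: "'a::real_normed_vector set"
  assumes "smooth_space TYPE('a)" and "compact M" "convex M" "0 \<in> interior M"
  shows "right_semipolar (left_semipolar M) = M"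
proof
  show "M \<subseteq> right_semipolar (left_semipolar M)"
    by (auto simp: right_semipolar_def left_semipolar_def)
  show "right_semipolar (left_semipolar M) \<subseteq> M"
  proof (rule subsetI, rule ccontr)
    fix x assume x: "x \<in> right_semipolar (left_semipolar M)" "x \<notin> M"
    obtain y where "y \<in> left_semipolar M" "semi_inner x y > 1"
      using left_semipolar_separates[OF assms x(2)] .
    with x(1) show False by (auto simp: right_semipolar_def)
  qed
qed

theorem theorem5p2:
  fixes M N :: "'a::real_normed_vector set" and c :: real
  assumes "finite_dimensional TYPE('a)"
    and "smooth_space TYPE('a)"
    and "strictly_convex_space TYPE('a)"
    and "c \<noteq> 0"
  shows "(M \<subseteq> N \<longrightarrow>
            right_semipolar N \<subseteq> right_semipolar M \<and> left_semipolar N \<subseteq> left_semipolar M)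
       \<and> (right_semipolar (M \<union> N) = right_semipolar M \<inter> right_semipolar N \<and>
          left_semipolar (M \<union> N) = left_semipolar M \<inter> left_semipolar N)
       \<and> (right_semipolar ((*\<^sub>R) c ` M) = (*\<^sub>R) (1 / c) ` right_semipolar M \<and>
          left_semipolar ((*\<^sub>R) c ` M) = (*\<^sub>R) (1 / c) ` left_semipolar M)
       \<and> (right_semipolar (cball (0::'a) 1) = cball 0 1 \<and>
          left_semipolar (cball (0::'a) 1) = cball 0 1)
       \<and> (convex_body M \<and> 0 \<in> interior M \<longrightarrow> right_semipolar (left_semipolar M) = M)"
  using assms(2,4)
  by (auto simp: semipolar_scaleR_image semipolar_cball right_semipolar_left_semipolar
        convex_body_def)
     (auto simp: right_semipolar_def left_semipolar_def)

end
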